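(* Let $\epsilon>0$ and set $\rho=\frac{\epsilon}{4D_f}$, $\mu=\frac{\epsilon}{4D_g}$, $\kappa=\frac{\epsilon}{2R^2}$. Let $(p_k)_{k\ge 0}$ be the sequence generated by the fast gradient method described in the context, applied to $\theta_{\rho,\mu,\kappa}$. Then for every integer $k\ge0$ satisfying both $$k \ge \frac{2}{\epsilon}\sqrt{\epsilon^2+8R^2\left(\|A\|^2D_f+D_g\right)}\;\ln\left(\frac{25\left(\theta(0)-\theta(p^* )+\frac{\epsilon}{2}\right)}{2\epsilon}\right)$$ and $$k\ge\frac{3}{\epsilon}\sqrt{\epsilon^2+8R^2\left(\|A\|^2D_f+D_g\right)}\;\ln\left(\frac{\sqrt[3]{\left(2\epsilon^2+16R^2(\|A\|^2D_f+D_g)\right)\left(\theta(0)-\theta(p^* )+\frac\epsilon2\right)}}{(2-\sqrt3)^{2/3}\,\epsilon}\right)$$ (thus after $O\left(\frac1\epsilon\ln\left(\frac1\epsilon\right)\right)$ iterations as $\epsilon\downarrow0$, for fixed problem data), the points $x_{\rho,p_k}\in\operatorname{dom} f$ and $x_{\mu,p_k}\in\operatorname{dom} g$ satisfy $$\left|f(x_{\rho,p_k})+g(x_{\mu,p_k})-v(D)\right|\le 2(1+2\sqrt3)\,\epsilon\quad\text{and}\quad\left\|Ax_{\rho,p_k}-x_{\mu,p_k}\right\|\le\frac{2\epsilon}{R};$$ in particular $f(x_{\rho,p_k})+g(x_{\mu,p_k})\le v(P)+2(1+2\sqrt3)\,\epsilon$.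
   Context: Let $f:\mathbb{R}^n\to\overline{\mathbb{R}}=\mathbb{R}\cup\{\pm\infty\}$ and $g:\mathbb{R}^m\to\overline{\mathbb{R}}$ be proper, convex and lower semicontinuous functions with bounded effective domains $\operatorname{dom} f=\{x: f(x)<+\infty\}$ and $\operatorname{dom} g$, and let $A:\mathbb{R}^n\to\mathbb{R}^m$ be linear with $A(\operatorname{dom} f)\cap\operatorname{dom} g\ne\emptyset$. Norms are Euclidean, $\|A\|$ is the operator norm, $A^*$ the adjoint, and $f^*(q)=\sup_x\{\langle q,x\rangle-f(x)\}$ the conjugate (similarly $g^*$); both conjugates are finite everywhere. The primal problem is $(P)$: $\inf_{x\in\mathbb{R}^n}\{f(x)+g(Ax)\}$, with optimal value $v(P)$. Its Fenchel dual is $(D)$: $\sup_{p\in\mathbb{R}^m}\{-f^*(A^*p)-g^*(-p)\}=-\inf_{p}\theta(p)$, where $\theta(p)=f^*(A^*p)+g^*(-p)$, with optimal value $v(D)$. It is assumed that $(D)$ has an optimal solution $p^*\in\mathbb{R}^m$ and that $R>0$ is a real number with $\|p^*\|\le R$; thus $\theta(p^* )=-v(D)$. Put $D_f=\sup\{\frac{\|x\|^2}{2}:x\in\operatorname{dom} f\}$ and $D_g=\sup\{\frac{\|x\|^2}{2}:x\in\operatorname{dom} g\}$, assumed positive (they are finite by boundedness). For $\rho,\mu,\kappa>0$ define $f_\rho^*(A^*p)=\sup_{x\in\mathbb{R}^n}\{\langle A^*p,x\rangle-f(x)-\frac\rho2\|x\|^2\}$, $g_\mu^*(-p)=\sup_{x\in\mathbb{R}^m}\{\langle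 -p,x\rangle-g(x)-\frac\mu2\|x\|^2\}$, $\theta_{\rho,\mu}(p)=f_\rho^*(A^*p)+g_\mu^*(-p)$ and $\theta_{\rho,\mu,\kappa}(p)=\theta_{\rho,\mu}(p)+\frac\kappa2\|p\|^2$. Denote by $x_{\rho,p}\in\operatorname{dom} f$ and $x_{\mu,p}\in\operatorname{dom} g$ the unique maximizers in the definitions of $f_\rho^*(A^*p)$ and $g_\mu^*(-p)$ respectively. Then $\theta_{\rho,\mu}$ and $\theta_{\rho,\mu,\kappa}$ are differentiable with $\nabla\theta_{\rho,\mu}(p)=Ax_{\rho,p}-x_{\mu,p}$ and $\nabla\theta_{\rho,\mu,\kappa}(p)=Ax_{\rho,p}-x_{\mu,p}+\kappa p$, and $\nabla\theta_{\rho,\mu,\kappa}$ is Lipschitz continuous with constant $L=\frac{\|A\|^2}{\rho}+\frac1\mu+\kappa$. Fast gradient method applied to $\theta_{\rho,\mu,\kappa}$: set $w_0=p_0=0\in\mathbb{R}^m$, and for $k\ge0$ $$p_{k+1}=w_k-\frac1L\nabla\theta_{\rho,\mu,\kappa}(w_k),\qquad w_{k+1}=p_{k+1}+\frac{\sqrt L-\sqrt\kappa}{\sqrt L+\sqrt\kappa}\,(p_{k+1}-p_k).$$ *)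

theory Defs
  imports "HOL-Analysis.Analysis" "HOL-Library.Landau_Symbols"
begin

section \<open>Extended-real-valued convex functions\<close>

definition effective_dom :: "('a \<Rightarrow> ereal) \<Rightarrow> 'a set" where
  "effective_dom f = {x. f x < \<infinity>}"

definition proper_fun :: "('a \<Rightarrow> ereal) \<Rightarrow> bool" where
  "proper_fun f \<longleftrightarrow> (\<forall>x. f x \<noteq> -\<infinity>) \<and> effective_dom f \<noteq> {}"

text \<open>
  Only used for proper functions, so that no sum of opposite infinities occurs on the
  right-hand side; for \<open>t = 0\<close> and \<open>t = 1\<close> the inequality is trivial, since \<open>0 * \<infinity> = 0\<close>
  in \<^typ>\<open>ereal\<close>.
\<close>
definition ereal_convex :: "('a::real_vector \<Rightarrow> ereal) \<Rightarrow> bool" where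
  "ereal_convex f \<longleftrightarrow>
     (\<forall>x y t. 0 \<le> t \<longrightarrow> t \<le> 1 \<longrightarrow>
        f ((1 - t) *\<^sub>R x + t *\<^sub>R y) \<le> ereal (1 - t) * f x + ereal t * f y)"

definition lower_semicontinuous :: "('a::topological_space \<Rightarrow> ereal) \<Rightarrow> bool" where
  "lower_semicontinuous f \<longleftrightarrow> (\<forall>x. f x \<le> Liminf (at x) f)"

definition conjugate :: "('a::real_inner \<Rightarrow> ereal) \<Rightarrow> 'a \<Rightarrow> ereal" where
  "conjugate f q = (SUP x. ereal (q \<bullet> x) - f x)"

definition half_sq_radius :: "'a::real_normed_vector set \<Rightarrow> real" where
  "half_sq_radius S = (SUP x\<in>S. (norm x)\<^sup>2 / 2)"


section \<open>The primal problem and its Fenchel dual\<close>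

definition primal_value ::
  "('a \<Rightarrow> ereal) \<Rightarrow> ('b \<Rightarrow> ereal) \<Rightarrow> ('a \<Rightarrow> 'b) \<Rightarrow> ereal" where
  "primal_value f g A = (INF x. f x + g (A x))"

definition dual_objective ::
  "('a::euclidean_space \<Rightarrow> ereal) \<Rightarrow> ('b::euclidean_space \<Rightarrow> ereal) \<Rightarrow> ('a \<Rightarrow> 'b) \<Rightarrow> 'b \<Rightarrow> ereal"
where
  "dual_objective f g A p = - conjugate f (adjoint A p) - conjugate g (- p)"

definition dual_value ::
  "('a::euclidean_space \<Rightarrow> ereal) \<Rightarrow> ('b::euclidean_space \<Rightarrow> ereal) \<Rightarrow> ('a \<Rightarrow> 'b) \<Rightarrow> ereal"
where
  "dual_value f g A = (SUP p. dual_objective f g A p)"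

definition theta ::
  "('a::euclidean_space \<Rightarrow> ereal) \<Rightarrow> ('b::euclidean_space \<Rightarrow> ereal) \<Rightarrow> ('a \<Rightarrow> 'b) \<Rightarrow> 'b \<Rightarrow> ereal"
where
  "theta f g A p = conjugate f (adjoint A p) + conjugate g (- p)"


section \<open>Double smoothing\<close>

definition smooth_objective ::
  "real \<Rightarrow> ('a::real_inner \<Rightarrow> ereal) \<Rightarrow> 'a \<Rightarrow> 'a \<Rightarrow> ereal" where
  "smooth_objective \<rho> f q x = ereal (q \<bullet> x) - f x - ereal (\<rho> / 2 * (norm x)\<^sup>2)"

definition smooth_conjugate :: "real \<Rightarrow> ('a::real_inner \<Rightarrow> ereal) \<Rightarrow> 'a \<Rightarrow> ereal" where
  "smooth_conjugate \<rho> f q = (SUP x. smooth_objective \<rho> f q x)"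

text \<open>
  For \<open>\<rho> > 0\<close> and \<open>f\<close> proper, convex and lower semicontinuous, the maximizer exists and is unique.
\<close>
definition smooth_maximizer :: "real \<Rightarrow> ('a::real_inner \<Rightarrow> ereal) \<Rightarrow> 'a \<Rightarrow> 'a" where
  "smooth_maximizer \<rho> f q = (THE x. is_arg_max (smooth_objective \<rho> f q) (\<lambda>_. True) x)"

definition theta_smooth ::
  "('a::euclidean_space \<Rightarrow> ereal) \<Rightarrow> ('b::euclidean_space \<Rightarrow> ereal) \<Rightarrow> ('a \<Rightarrow> 'b) \<Rightarrow>
     real \<Rightarrow> real \<Rightarrow> 'b \<Rightarrow> ereal"
where
  "theta_smooth f g A \<rho> \<mu> p = smooth_conjugate \<rho> f (adjoint A p) + smooth_conjugate \<mu> g (- p)"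

definition theta_double_smooth ::
  "('a::euclidean_space \<Rightarrow> ereal) \<Rightarrow> ('b::euclidean_space \<Rightarrow> ereal) \<Rightarrow> ('a \<Rightarrow> 'b) \<Rightarrow>
     real \<Rightarrow> real \<Rightarrow> real \<Rightarrow> 'b \<Rightarrow> ereal"
where
  "theta_double_smooth f g A \<rho> \<mu> \<kappa> p = theta_smooth f g A \<rho> \<mu> p + ereal (\<kappa> / 2 * (norm p)\<^sup>2)"


section \<open>The fast gradient method\<close>

definition gradient :: "('a::real_inner \<Rightarrow> real) \<Rightarrow> 'a \<Rightarrow> 'a" where
  "gradient F p = (THE D. GDERIV F p :> D)"

text \<open>The \<open>k\<close>-th component of the run is the pair \<open>(p\<^sub>k, w\<^sub>k)\<close>.\<close>
primrec fast_gradient_run ::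
  "('a::real_inner \<Rightarrow> real) \<Rightarrow> real \<Rightarrow> real \<Rightarrow> 'a \<Rightarrow> nat \<Rightarrow> 'a \<times> 'a"
where
  "fast_gradient_run F L \<kappa> p0 0 = (p0, p0)"
| "fast_gradient_run F L \<kappa> p0 (Suc k) =
     (let (p, w) = fast_gradient_run F L \<kappa> p0 k;
          p' = w - (1 / L) *\<^sub>R gradient F w
      in (p', p' + ((sqrt L - sqrt \<kappa>) / (sqrt L + sqrt \<kappa>)) *\<^sub>R (p' - p)))"

definition fast_gradient ::
  "('a::real_inner \<Rightarrow> real) \<Rightarrow> real \<Rightarrow> real \<Rightarrow> 'a \<Rightarrow> nat \<Rightarrow> 'a"
where
  "fast_gradient F L \<kappa> p0 k = fst (fast_gradient_run F L \<kappa> p0 k)"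

end

theory Submission
  imports Defs "HOL-Real_Asymp.Real_Asymp"
begin

text \<open>
  Strong concavity of \<open>\<langle>q, x\<rangle> - f x - \<rho>/2 \<parallel>x\<parallel>\<^sup>2\<close> at its maximizer yields two-sided quadratic bounds for
  \<open>\<theta>\<^bsub>\<rho>,\<mu>,\<kappa>\<^esub>\<close> around every point, from which both its gradient and the linear rate
  \<open>exp (- k \<surd>(\<kappa>/L))\<close> of the fast gradient method follow directly. Write \<open>X = \<theta>(0) - \<theta>(p\<^sup>*) + \<epsilon>/2\<close>,
  which bounds the initial gap since \<open>\<theta>\<^bsub>\<rho>,\<mu>\<^esub> \<le> \<theta> \<le> \<theta>\<^bsub>\<rho>,\<mu>\<^esub> + \<epsilon>/2\<close>; the gap after \<open>k\<close> steps is at most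
  \<open>2 X exp (- k \<surd>(\<kappa>/L))\<close>. The first lower bound on \<open>k\<close> makes it at most \<open>16\<epsilon>/625\<close>, which puts
  \<open>p\<^sub>k\<close> within \<open>8R/25\<close> of the minimizer \<open>m\<close> of \<open>\<theta>\<^bsub>\<rho>,\<mu>,\<kappa>\<^esub>\<close>; as \<open>\<parallel>m\<parallel> \<le> \<surd>3 R\<close>, this gives
  \<open>\<parallel>p\<^sub>k\<parallel> \<le> 2\<surd>3 R\<close>. The second makes the gradient at \<open>p\<^sub>k\<close> at most \<open>(2 - \<surd>3)\<epsilon>/R\<close>, and removing the
  regularization term \<open>\<kappa> p\<^sub>k\<close> costs at most \<open>\<surd>3 \<epsilon>/R\<close>. Finally \<open>f + g\<close> at the maximizers
  differs from \<open>- \<theta>\<^bsub>\<rho>,\<mu>\<^esub>(p\<^sub>k)\<close> by \<open>\<langle>p\<^sub>k, A x - y\<rangle>\<close> up to \<open>\<epsilon>/2\<close>.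
\<close>

section \<open>Minimization of lower semicontinuous functions\<close>

text \<open>\<open>Liminf (at x) f\<close> controls only the punctured neighbourhood; the point
  \<open>x\<close> itself is covered by \<open>c < f x\<close>.\<close>

lemma lower_semicontinuous_eventually:
  assumes "lower_semicontinuous f" "c < f x"
  shows "eventually (\<lambda>y. c < f y) (nhds x)"
proof -
  have "c < Liminf (at x) f"
    using assms unfolding lower_semicontinuous_def by (meson less_le_trans)
  then have "eventually (\<lambda>y. c < f y) (at x)"
    by (rule less_LiminfD)
  with assms(2) show ?thesis
    by (auto simp: eventually_at_filter elim: eventually_mono)
qed

lemma lower_semicontinuous_add_continuous:
  fixes r :: "'a::topological_space \<Rightarrow> real"
  assumes f: "lower_semicontinuous f" and pr: "\<And>x. f x \<noteq> -\<infinity>" and r: "continuous_on UNIV r"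
  shows "lower_semicontinuous (\<lambda>x. f x + ereal (r x))"
  unfolding lower_semicontinuous_def
proof (intro allI)
  fix x
  show "f x + ereal (r x) \<le> Liminf (at x) (\<lambda>x. f x + ereal (r x))"
    unfolding le_Liminf_iff
  proof (intro allI impI)
    fix c assume "c < f x + ereal (r x)"
    then obtain c' where c': "c < ereal c'" "ereal c' < f x + ereal (r x)"
      by (metis ereal_dense2)
    then have "ereal (c' - r x) < f x"
      by (cases "f x") auto
    \<comment> \<open>Splitting the slack at \<open>d\<close> lets \<open>f\<close> stay above
      \<open>d\<close> and \<open>r\<close> above \<open>c' - d\<close> near \<open>x\<close>, so
      the sum stays above \<open>c'\<close>.\<close>
    then obtain d where d: "ereal (c' - r x) < ereal d" "ereal d < f x"
      by (metis ereal_dense2)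
    have 1: "eventually (\<lambda>y. ereal d < f y) (nhds x)"
      using f d(2) by (rule lower_semicontinuous_eventually)
    have "(r \<longlongrightarrow> r x) (at x)"
      using r by (simp add: continuous_on_def)
    then have "eventually (\<lambda>y. c' - d < r y) (at x)"
      using d(1) by (auto elim: order_tendstoD(1))
    moreover have "eventually (\<lambda>y. ereal d < f y) (at x)"
      using 1 by (auto simp: eventually_at_filter elim: eventually_mono)
    ultimately show "eventually (\<lambda>y. c < f y + ereal (r y)) (at x)"
    proof eventually_elim
      case (elim y)
      then have "ereal c' < f y + ereal (r y)"
        by (cases "f y") auto
      with c'(1) show ?case by simp
    qed
  qed
qed

lemma closed_sublevel_lower_semicontinuous:
  assumes "lower_semicontinuous h"
  shows "closed {x. h x \<le> c}"
proof -
  have "open (- {x. h x \<le> c})"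
  proof (subst open_subopen, intro ballI)
    fix x assume "x \<in> - {x. h x \<le> c}"
    then have "eventually (\<lambda>y. c < h y) (nhds x)"
      by (intro lower_semicontinuous_eventually assms) auto
    then show "\<exists>T. open T \<and> x \<in> T \<and> T \<subseteq> - {x. h x \<le> c}"
      by (auto simp: eventually_nhds not_le subset_eq)
  qed
  then show ?thesis by (simp add: closed_def)
qed

text \<open>The sublevel sets \<open>S z\<close> are closed, and \<open>S z0\<close> is compact
  since it lies in the bounded domain. Among finitely many \<open>z\<close> the one of smallest
  value lies in all their sets, so all sets share a point, which is a minimizer.\<close>

lemma lower_semicontinuous_attains_inf:
  fixes h :: "'a::heine_borel \<Rightarrow> ereal"
  assumes h: "lower_semicontinuous h" and bdd: "bounded (effective_dom h)"
    and ne: "effective_dom h \<noteq> {}"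
  obtains x where "x \<in> effective_dom h" "\<And>z. h x \<le> h z"
proof -
  define S where "S z = {x. h x \<le> h z}" for z
  obtain z0 where z0: "z0 \<in> effective_dom h"
    using ne by blast
  have closed: "closed (S z)" for z
    unfolding S_def by (rule closed_sublevel_lower_semicontinuous[OF h])
  have sub: "S z0 \<subseteq> effective_dom h"
    using z0 by (auto simp: S_def effective_dom_def intro: le_less_trans)
  have "S z0 \<inter> (\<Inter>z\<in>effective_dom h. S z) \<noteq> {}"
  proof (rule compact_imp_fip_image)
    show "compact (S z0)"
      using closed sub bdd by (auto simp: compact_eq_bounded_closed intro: bounded_subset)
    fix Z assume Z: "finite Z" "Z \<subseteq> effective_dom h"
    obtain m where "m \<in> insert z0 Z" "\<forall>z\<in>insert z0 Z. h m \<le> h z"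
      using ex_is_arg_min_if_finite[of "insert z0 Z" h] Z
      by (auto simp: is_arg_min_linorder)
    then have "m \<in> S z0 \<inter> (\<Inter>z\<in>Z. S z)"
      by (auto simp: S_def)
    then show "S z0 \<inter> (\<Inter>z\<in>Z. S z) \<noteq> {}" by blast
  qed (rule closed)
  then obtain x where x: "x \<in> S z0" "\<And>z. z \<in> effective_dom h \<Longrightarrow> x \<in> S z"
    by blast
  have "h x \<le> h z" for z
    using x(2)[of z] by (cases "z \<in> effective_dom h") (auto simp: S_def effective_dom_def)
  with x(1) sub show thesis
    using that by blast
qed

section \<open>Smoothed conjugates\<close>

text \<open>Young's inequality, from expanding the square of
  \<open>norm (a - \<rho> *\<^sub>R b)\<close>.\<close>

lemma inner_le_young:
  fixes a b :: "'a::real_inner"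
  assumes "\<rho> > 0"
  shows "a \<bullet> b \<le> (norm a)\<^sup>2 / (2 * \<rho>) + \<rho> / 2 * (norm b)\<^sup>2"
proof -
  have "0 \<le> (norm (a - \<rho> *\<^sub>R b))\<^sup>2 / (2 * \<rho>)"
    using assms by simp
  also have "\<dots> = (norm a)\<^sup>2 / (2 * \<rho>) + \<rho> / 2 * (norm b)\<^sup>2 - a \<bullet> b"
    unfolding power2_norm_eq_inner using assms
    by (simp add: inner_diff inner_commute field_simps)
  finally show ?thesis by simp
qed

locale bounded_convex_fun =
  fixes f :: "'a::euclidean_space \<Rightarrow> ereal"
  assumes proper: "proper_fun f" and convex: "ereal_convex f"
    and lsc: "lower_semicontinuous f" and bdd: "bounded (effective_dom f)"
begin

text \<open>Meaningful on the effective domain only: where \<open>f x = \<infinity>\<close>,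
  \<open>real_of_ereal\<close> returns the default value 0.\<close>

definition real_objective :: "real \<Rightarrow> 'a \<Rightarrow> 'a \<Rightarrow> real" where
  "real_objective \<rho> q x = q \<bullet> x - real_of_ereal (f x) - \<rho> / 2 * (norm x)\<^sup>2"

lemma not_MInfty: "f x \<noteq> -\<infinity>"
  using proper by (simp add: proper_fun_def)

lemma ereal_real_on_dom: "x \<in> effective_dom f \<Longrightarrow> ereal (real_of_ereal (f x)) = f x"
  using not_MInfty[of x] by (cases "f x") (auto simp: effective_dom_def)

lemma smooth_objective_on_dom:
  "x \<in> effective_dom f \<Longrightarrow> smooth_objective \<rho> f q x = ereal (real_objective \<rho> q x)"
  using not_MInfty[of x]
  by (cases "f x") (auto simp: effective_dom_def smooth_objective_def real_objective_def)

lemma smooth_objective_off_dom: "x \<notin> effective_dom f \<Longrightarrow> smooth_objective \<rho> f q x = -\<infinity>"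
  by (auto simp: effective_dom_def smooth_objective_def)

lemma
  assumes xy: "x \<in> effective_dom f" "y \<in> effective_dom f" and t: "0 \<le> t" "t \<le> 1"
  shows convex_combination_in_dom: "(1 - t) *\<^sub>R x + t *\<^sub>R y \<in> effective_dom f" (is "?z \<in> _")
    and real_convex_on_dom:
      "real_of_ereal (f ((1 - t) *\<^sub>R x + t *\<^sub>R y))
        \<le> (1 - t) * real_of_ereal (f x) + t * real_of_ereal (f y)"
proof -
  have "f ?z \<le> ereal (1 - t) * f x + ereal t * f y"
    using convex t by (simp add: ereal_convex_def)
  also have "\<dots> = ereal ((1 - t) * real_of_ereal (f x) + t * real_of_ereal (f y))"
    by (metis ereal_real_on_dom[OF xy(1)] ereal_real_on_dom[OF xy(2)]
        plus_ereal.simps(1) times_ereal.simps(1))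
  finally have le: "f ?z \<le> \<dots>" .
  then show z: "?z \<in> effective_dom f"
    by (auto simp: effective_dom_def intro: le_less_trans)
  show "real_of_ereal (f ?z) \<le> (1 - t) * real_of_ereal (f x) + t * real_of_ereal (f y)"
    using le ereal_real_on_dom[OF z] by (metis ereal_less_eq(3))
qed

text \<open>Attainment comes from lower semicontinuity and the bounded domain rather than from
  strong concavity, so \<open>\<rho>\<close> may be 0 and the unsmoothed conjugate is
  covered.\<close>

lemma ex_smooth_objective_max:
  obtains x where "x \<in> effective_dom f"
    "\<And>z. smooth_objective \<rho> f q z \<le> smooth_objective \<rho> f q x"
proof -
  define r where "r z = \<rho> / 2 * (norm z)\<^sup>2 - q \<bullet> z" for z
  define h where "h z = f z + ereal (r z)" for z
  have "continuous_on UNIV r"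
    unfolding r_def by (intro continuous_intros)
  then have "lower_semicontinuous h"
    unfolding h_def by (intro lower_semicontinuous_add_continuous lsc not_MInfty)
  moreover have dom: "effective_dom h = effective_dom f"
    by (auto simp: effective_dom_def h_def)
  moreover have "effective_dom f \<noteq> {}"
    using proper by (simp add: proper_fun_def)
  ultimately obtain x where x: "x \<in> effective_dom f" "\<And>z. h x \<le> h z"
    using bdd lower_semicontinuous_attains_inf[of h] by metis
  have "smooth_objective \<rho> f q z = - h z" for z
    using not_MInfty[of z]
    by (cases "f z") (auto simp: smooth_objective_def h_def r_def)
  with x show thesis
    by (auto intro: that)
qed

text \<open>The maximizer is compared with a point on the segment towards \<open>z\<close>. Dividing
  by \<open>t\<close> leaves the quadratic gain with a factor \<open>1 - t\<close>, which disappears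
  as \<open>t\<close> decreases to 0.\<close>

lemma strong_concavity_at_max:
  assumes x: "x \<in> effective_dom f" "\<And>z. smooth_objective \<rho> f q z \<le> smooth_objective \<rho> f q x"
    and z: "z \<in> effective_dom f"
  shows "real_objective \<rho> q z + \<rho> / 2 * (norm (z - x))\<^sup>2 \<le> real_objective \<rho> q x"
proof -
  let ?\<psi> = "real_objective \<rho> q"
  have step: "?\<psi> z + \<rho> / 2 * (1 - t) * (norm (z - x))\<^sup>2 \<le> ?\<psi> x" if t: "0 < t" "t < 1" for t
  proof -
    let ?w = "(1 - t) *\<^sub>R x + t *\<^sub>R z"
    have w: "?w \<in> effective_dom f"
      using convex_combination_in_dom[OF x(1) z] t by simp
    have id: "(norm ?w)\<^sup>2 = (1 - t) * (norm x)\<^sup>2 + t * (norm z)\<^sup>2 - t * (1 - t) * (norm (z - x))\<^sup>2"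
      unfolding power2_norm_eq_inner by (simp add: algebra_simps inner_commute)
    have "?\<psi> ?w \<le> ?\<psi> x"
      using x(2)[of ?w] smooth_objective_on_dom[OF w] smooth_objective_on_dom[OF x(1)] by simp
    moreover have "(1 - t) * ?\<psi> x + t * ?\<psi> z + \<rho> / 2 * (t * (1 - t) * (norm (z - x))\<^sup>2) \<le> ?\<psi> ?w"
      using real_convex_on_dom[OF x(1) z, of t] t
      unfolding real_objective_def id
      by (simp add: algebra_simps add_divide_distrib diff_divide_distrib)
    ultimately have "t * (?\<psi> z + \<rho> / 2 * (1 - t) * (norm (z - x))\<^sup>2) \<le> t * ?\<psi> x"
      by (simp add: algebra_simps add_divide_distrib diff_divide_distrib)
    with t(1) show ?thesis by simp
  qed
  have "eventually (\<lambda>t. ?\<psi> z + \<rho> / 2 * (1 - t) * (norm (z - x))\<^sup>2 \<le> ?\<psi> x) (at_right (0::real))"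
    by (rule eventually_mono[OF eventually_at_right_real[of 0 1]]) (use step in auto)
  moreover have "((\<lambda>t. ?\<psi> z + \<rho> / 2 * (1 - t) * (norm (z - x))\<^sup>2) \<longlongrightarrow>
      ?\<psi> z + \<rho> / 2 * (1 - 0) * (norm (z - x))\<^sup>2) (at_right (0::real))"
    by (intro tendsto_intros)
  ultimately show ?thesis
    using tendsto_upperbound[OF _ _ trivial_limit_at_right_real] by fastforce
qed

text \<open>Strong concavity with \<open>\<rho> > 0\<close> puts any second maximizer at distance 0
  from the first, so the definite description in \<open>smooth_maximizer\<close> denotes the
  maximizer.\<close>

lemma
  assumes \<rho>: "\<rho> > 0"
  shows smooth_maximizer_in_dom: "smooth_maximizer \<rho> f q \<in> effective_dom f"
    and smooth_maximizer_max:
      "smooth_objective \<rho> f q z \<le> smooth_objective \<rho> f q (smooth_maximizer \<rho> f q)"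
proof -
  let ?o = "smooth_objective \<rho> f q"
  obtain x where x: "x \<in> effective_dom f" "\<And>z. ?o z \<le> ?o x"
    using ex_smooth_objective_max by blast
  have "smooth_maximizer \<rho> f q = x"
    unfolding smooth_maximizer_def
  proof (rule the_equality)
    show "is_arg_max ?o (\<lambda>_. True) x"
      using x(2) by (simp add: is_arg_max_linorder)
    fix y assume "is_arg_max ?o (\<lambda>_. True) y"
    then have eq: "?o y = ?o x"
      using x(2) by (auto simp: is_arg_max_linorder intro: antisym)
    then have y: "y \<in> effective_dom f"
      using smooth_objective_off_dom[of y] smooth_objective_on_dom[OF x(1)] by force
    have "\<rho> / 2 * (norm (y - x))\<^sup>2 \<le> 0"
      using strong_concavity_at_max[OF x y] eq
      by (simp add: smooth_objective_on_dom[OF x(1)] smooth_objective_on_dom[OF y])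
    with \<rho> show "y = x"
      by (simp add: mult_le_0_iff)
  qed
  with x show "smooth_maximizer \<rho> f q \<in> effective_dom f"
    "?o z \<le> ?o (smooth_maximizer \<rho> f q)" by auto
qed

section \<open>Values and quadratic bounds of the smoothed conjugate\<close>

lemma smooth_conjugate_eq_max:
  assumes "x \<in> effective_dom f" "\<And>z. smooth_objective \<rho> f q z \<le> smooth_objective \<rho> f q x"
  shows "smooth_conjugate \<rho> f q = ereal (real_objective \<rho> q x)"
  unfolding smooth_conjugate_def
  using assms by (auto intro!: antisym SUP_least SUP_upper simp flip: smooth_objective_on_dom)

lemma smooth_conjugate_finite:
  "ereal (real_of_ereal (smooth_conjugate \<rho> f q)) = smooth_conjugate \<rho> f q"
  using ex_smooth_objective_max[of \<rho> q] smooth_conjugate_eq_max[of _ \<rho> q]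
  by (metis real_of_ereal.simps(1))

lemma smooth_conjugate_eq:
  "\<rho> > 0 \<Longrightarrow> real_of_ereal (smooth_conjugate \<rho> f q) = real_objective \<rho> q (smooth_maximizer \<rho> f q)"
  by (subst smooth_conjugate_eq_max[OF smooth_maximizer_in_dom smooth_maximizer_max]) auto

lemma real_objective_le_smooth_conjugate:
  assumes "x \<in> effective_dom f"
  shows "real_objective \<rho> q x \<le> real_of_ereal (smooth_conjugate \<rho> f q)"
proof -
  have "ereal (real_objective \<rho> q x) \<le> smooth_conjugate \<rho> f q"
    unfolding smooth_conjugate_def smooth_objective_on_dom[OF assms, symmetric]
    by (rule SUP_upper) simp
  then show ?thesis
    by (metis ereal_less_eq(3) smooth_conjugate_finite)
qed

lemma conjugate_eq_smooth_conjugate: "conjugate f q = smooth_conjugate 0 f q"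
  by (simp add: conjugate_def smooth_conjugate_def smooth_objective_def zero_ereal_def[symmetric])

lemma conjugate_finite: "ereal (real_of_ereal (conjugate f q)) = conjugate f q"
  by (simp add: conjugate_eq_smooth_conjugate smooth_conjugate_finite)

lemma half_sq_norm_le_radius:
  assumes "x \<in> effective_dom f"
  shows "(norm x)\<^sup>2 / 2 \<le> half_sq_radius (effective_dom f)"
  unfolding half_sq_radius_def
proof (rule cSUP_upper[OF assms])
  obtain B where B: "\<And>x. x \<in> effective_dom f \<Longrightarrow> norm x \<le> B"
    using bdd by (auto simp: bounded_iff)
  then show "bdd_above ((\<lambda>x. (norm x)\<^sup>2 / 2) ` effective_dom f)"
    by (auto intro!: bdd_aboveI2[where M = "B\<^sup>2 / 2"] power_mono divide_right_mono)
qed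

lemma smooth_conjugate_le_conjugate:
  assumes "\<rho> > 0"
  shows "real_of_ereal (smooth_conjugate \<rho> f q) \<le> real_of_ereal (conjugate f q)"
proof -
  let ?x = "smooth_maximizer \<rho> f q"
  have "real_objective \<rho> q ?x \<le> real_objective 0 q ?x"
    using assms by (simp add: real_objective_def)
  also have "\<dots> \<le> real_of_ereal (conjugate f q)"
    using real_objective_le_smooth_conjugate[of ?x 0 q] smooth_maximizer_in_dom[OF assms]
    by (simp add: conjugate_eq_smooth_conjugate)
  finally show ?thesis by (simp add: smooth_conjugate_eq assms)
qed

text \<open>A maximizer of the unsmoothed problem is a candidate in the smoothed one, where it loses
  only its own quadratic term.\<close>

lemma conjugate_le_smooth_conjugate:
  assumes "\<rho> > 0"
  shows "real_of_ereal (conjugate f q)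
    \<le> real_of_ereal (smooth_conjugate \<rho> f q) + \<rho> * half_sq_radius (effective_dom f)"
proof -
  obtain x where x: "x \<in> effective_dom f"
    "\<And>z. smooth_objective 0 f q z \<le> smooth_objective 0 f q x"
    using ex_smooth_objective_max by blast
  have "real_of_ereal (conjugate f q) = real_objective \<rho> q x + \<rho> * ((norm x)\<^sup>2 / 2)"
    using smooth_conjugate_eq_max[OF x]
    by (simp add: conjugate_eq_smooth_conjugate real_objective_def)
  also have "\<dots> \<le> real_of_ereal (smooth_conjugate \<rho> f q) + \<rho> * half_sq_radius (effective_dom f)"
    using assms real_objective_le_smooth_conjugate[OF x(1)] half_sq_norm_le_radius[OF x(1)]
    by (intro add_mono mult_left_mono) auto
  finally show ?thesis .
qed

text \<open>The maximizer at \<open>q\<close> is a candidate in the supremum at \<open>q'\<close>;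
  hence it is a subgradient at \<open>q\<close>.\<close>

lemma smooth_conjugate_lower:
  assumes \<rho>: "\<rho> > 0"
  shows "real_of_ereal (smooth_conjugate \<rho> f q) + (q' - q) \<bullet> smooth_maximizer \<rho> f q
    \<le> real_of_ereal (smooth_conjugate \<rho> f q')"
  using real_objective_le_smooth_conjugate[OF smooth_maximizer_in_dom[OF \<rho>], of \<rho> q' q]
  by (simp add: smooth_conjugate_eq[OF \<rho>] real_objective_def inner_diff_left)

text \<open>Strong concavity at the maximizer for \<open>q\<close> supplies
  \<open>\<rho> / 2 * (norm ?d)\<^sup>2\<close>, exactly the term that Young's inequality costs;
  what remains is smoothness with constant \<open>1 / \<rho>\<close>.\<close>

lemma smooth_conjugate_upper:
  assumes \<rho>: "\<rho> > 0"
  shows "real_of_ereal (smooth_conjugate \<rho> f q')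
    \<le> real_of_ereal (smooth_conjugate \<rho> f q) + (q' - q) \<bullet> smooth_maximizer \<rho> f q
      + (norm (q' - q))\<^sup>2 / (2 * \<rho>)"
proof -
  let ?x = "smooth_maximizer \<rho> f q" and ?x' = "smooth_maximizer \<rho> f q'"
  let ?d = "?x' - ?x"
  have "real_objective \<rho> q' ?x' = real_objective \<rho> q ?x' + (q' - q) \<bullet> ?x + (q' - q) \<bullet> ?d"
    by (simp add: real_objective_def algebra_simps)
  moreover have "real_objective \<rho> q ?x' + \<rho> / 2 * (norm ?d)\<^sup>2 \<le> real_objective \<rho> q ?x"
    using \<rho> by (intro strong_concavity_at_max smooth_maximizer_in_dom smooth_maximizer_max)
  moreover have "(q' - q) \<bullet> ?d \<le> (norm (q' - q))\<^sup>2 / (2 * \<rho>) + \<rho> / 2 * (norm ?d)\<^sup>2"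
    by (rule inner_le_young[OF \<rho>])
  ultimately show ?thesis
    unfolding smooth_conjugate_eq[OF \<rho>] by linarith
qed

end

section \<open>The fast gradient method\<close>

text \<open>
  The two inequalities say that \<open>F\<close> is \<open>\<kappa>\<close>-strongly convex with \<open>L\<close>-Lipschitz gradient \<open>G\<close>;
  in this quadratic form they are all that the fast gradient method needs.
\<close>
locale smooth_strongly_convex =
  fixes F :: "'a::euclidean_space \<Rightarrow> real" and G :: "'a \<Rightarrow> 'a" and L \<kappa> :: real
  assumes \<kappa>: "\<kappa> > 0"
    and lower: "\<And>p q. F p + G p \<bullet> (q - p) + \<kappa> / 2 * (norm (q - p))\<^sup>2 \<le> F q"
    and upper: "\<And>p q. F q \<le> F p + G p \<bullet> (q - p) + L / 2 * (norm (q - p))\<^sup>2"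
begin

text \<open>The two bounds confine the remainder to a multiple of
  \<open>(norm (q - p))\<^sup>2\<close>. The absolute value of \<open>L\<close> appears because the
  locale states no sign for it.\<close>

lemma gderiv: "GDERIV F p :> G p"
proof -
  have *: "\<bar>F q - F p - (q - p) \<bullet> G p\<bar> \<le> \<bar>L\<bar> / 2 * (norm (q - p))\<^sup>2" for q
  proof -
    have "L / 2 * (norm (q - p))\<^sup>2 \<le> \<bar>L\<bar> / 2 * (norm (q - p))\<^sup>2"
      by (intro mult_right_mono) auto
    moreover have "0 \<le> \<kappa> / 2 * (norm (q - p))\<^sup>2"
      using \<kappa> by simp
    ultimately show ?thesis
      using lower[of p q] upper[of q p] by (simp add: inner_commute)
  qed
  show ?thesis
    unfolding gderiv_def has_derivative_def
  proof
    show "bounded_linear (\<lambda>h. h \<bullet> G p)"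
      by (rule bounded_linear_inner_left)
    have "((\<lambda>q. \<bar>L\<bar> / 2 * norm (q - p)) \<longlongrightarrow> \<bar>L\<bar> / 2 * norm (p - p)) (at p)"
      by (intro tendsto_intros)
    then have lim: "((\<lambda>q. \<bar>L\<bar> / 2 * norm (q - p)) \<longlongrightarrow> 0) (at p)"
      by simp
    have "((\<lambda>q. (F q - F p - (q - p) \<bullet> G p) /\<^sub>R norm (q - p)) \<longlongrightarrow> 0) (at p)"
    proof (rule tendsto_0_le[OF lim, of _ 1], intro always_eventually allI)
      fix q
      show "norm ((F q - F p - (q - p) \<bullet> G p) /\<^sub>R norm (q - p)) \<le> norm (\<bar>L\<bar> / 2 * norm (q - p)) * 1"
        using *[of q]
        by (cases "q = p") (auto simp: abs_mult divide_simps power2_eq_square mult_ac)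
    qed
    \<comment> \<open>The definition of the derivative names the base point \<open>p\<close> as
      \<open>Lim (at p) (\<lambda>x. x)\<close>.\<close>
    then show "((\<lambda>q. (F q - F (Lim (at p) (\<lambda>x. x)) - (q - Lim (at p) (\<lambda>x. x)) \<bullet> G p) /\<^sub>R
        norm (q - Lim (at p) (\<lambda>x. x))) \<longlongrightarrow> 0) (at p)"
      by (simp add: Lim_ident_at)
  qed
qed

lemma gradient_eq: "gradient F p = G p"
  unfolding gradient_def
proof (rule the_equality, rule gderiv)
  fix D assume "GDERIV F p :> D"
  then have "(\<lambda>h. h \<bullet> D) = (\<lambda>h. h \<bullet> G p)"
    using gderiv unfolding gderiv_def by (rule has_derivative_unique)
  then show "D = G p"
    by (metis inner_commute vector_eq_ldot)
qed

lemma continuous_on: "continuous_on S F"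
  by (metis continuous_at_imp_continuous_on gderiv gderiv_def has_derivative_continuous)

lemma attains_min:
  obtains m where "\<And>q. F m \<le> F q"
proof -
  \<comment> \<open>Beyond this radius the strong convexity term outweighs the linear term
    \<open>G 0 \<bullet> q\<close>, so \<open>F 0 \<le> F q\<close> and minimizing over the ball
    suffices.\<close>
  define r where "r = 2 * norm (G 0) / \<kappa>"
  have "\<exists>m\<in>cball 0 r. \<forall>q\<in>cball 0 r. F m \<le> F q"
    using \<kappa> by (intro continuous_attains_inf continuous_on) (auto simp: r_def not_less)
  then obtain m where m: "norm m \<le> r" "\<And>q. norm q \<le> r \<Longrightarrow> F m \<le> F q"
    by auto
  have "F m \<le> F q" if "norm q > r" for q
  proof -
    have "2 * norm (G 0) < \<kappa> * norm q"
      using that \<kappa> by (simp add: r_def field_simps)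
    then have "0 \<le> norm q * (\<kappa> / 2 * norm q - norm (G 0))"
      by simp
    then have "norm (G 0) * norm q \<le> \<kappa> / 2 * (norm q)\<^sup>2"
      by (simp add: power2_eq_square algebra_simps)
    moreover have "- (norm (G 0) * norm q) \<le> G 0 \<bullet> q"
      using Cauchy_Schwarz_ineq2[of "G 0" q] by linarith
    ultimately have "F 0 \<le> F q"
      using lower[of 0 q] by simp
    then show ?thesis
      using m(2)[of 0] \<kappa> by (simp add: r_def)
  qed
  with m(2) show thesis
    by (meson not_le that)
qed

section \<open>Gradient steps and the linear convergence rate\<close>

context
  assumes L: "\<kappa> \<le> L"
begin

text \<open>The step goes to the minimizer of the quadratic upper model of \<open>F\<close> at
  \<open>w\<close>.\<close>

lemma gradient_step: "F (w - (1 / L) *\<^sub>R G w) \<le> F w - (norm (G w))\<^sup>2 / (2 * L)"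
  using upper[of "w - (1 / L) *\<^sub>R G w" w] L \<kappa>
  by (simp add: power2_norm_eq_inner[symmetric] power_divide power2_eq_square field_simps)

text \<open>A gradient step from \<open>p\<close> cannot fall below \<open>F m\<close>, so its
  guaranteed decrease is at most the gap.\<close>

lemma gradient_le_gap:
  assumes "\<And>q. F m \<le> F q"
  shows "(norm (G p))\<^sup>2 \<le> 2 * L * (F p - F m)"
proof -
  have "F m \<le> F p - (norm (G p))\<^sup>2 / (2 * L)"
    using assms gradient_step by (rule order_trans)
  then show ?thesis
    using L \<kappa> by (simp add: field_simps)
qed

text \<open>At \<open>p = m\<close> the gap is 0, so \<open>gradient_le_gap\<close> gives
  \<open>G m = 0\<close> and the linear term of \<open>lower\<close> disappears.\<close>

lemma quadratic_growth:
  assumes "\<And>q. F m \<le> F q"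
  shows "\<kappa> / 2 * (norm (p - m))\<^sup>2 \<le> F p - F m"
  using gradient_le_gap[OF assms, of m] lower[of m p] by simp

abbreviation "momentum \<equiv> (sqrt L - sqrt \<kappa>) / (sqrt L + sqrt \<kappa>)"

text \<open>
  The auxiliary point \<open>v = w + (w - p) / \<alpha>\<close> of Nesterov's estimate sequence turns the
  momentum step into \<open>v' = (1 - \<alpha>) v + \<alpha> w - (\<alpha> / \<kappa>) G w\<close>, so that the potential
  \<open>F p + \<kappa>/2 \<parallel>v - u\<parallel>\<^sup>2\<close> contracts by \<open>1 - \<alpha>\<close> towards \<open>F u\<close>, for every \<open>u\<close>.
\<close>
lemma lyapunov_step:
  assumes \<alpha>: "\<alpha> = sqrt (\<kappa> / L)"
    and p': "p' = w - (1 / L) *\<^sub>R G w" and w': "w' = p' + momentum *\<^sub>R (p' - p)"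
  shows "F p' - F u + \<kappa> / 2 * (norm (w' + (1 / \<alpha>) *\<^sub>R (w' - p') - u))\<^sup>2
    \<le> (1 - \<alpha>) * (F p - F u + \<kappa> / 2 * (norm (w + (1 / \<alpha>) *\<^sub>R (w - p) - u))\<^sup>2)"
proof -
  have Lpos: "L > 0" using L \<kappa> by simp
  have \<alpha>01: "0 < \<alpha>" "\<alpha> \<le> 1"
    using L \<kappa> Lpos by (auto simp: \<alpha>)
  have \<alpha>2: "\<alpha>\<^sup>2 = \<kappa> / L"
    using \<kappa> Lpos by (simp add: \<alpha>)
  have mom: "momentum = (1 - \<alpha>) / (1 + \<alpha>)"
  proof -
    have "(s - t) / (s + t) = (1 - t / s) / (1 + t / s)" if "s > 0" "t > 0" for s t :: real
      using that by (simp add: divide_simps)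
    from this[of "sqrt L" "sqrt \<kappa>"] show ?thesis
      unfolding \<alpha> real_sqrt_divide using Lpos \<kappa> by (meson real_sqrt_gt_zero)
  qed
  have "(1 + 1 / \<alpha>) * momentum = 1 / \<alpha> - 1"
  proof -
    have "1 + 1 / \<alpha> = (1 + \<alpha>) / \<alpha>" "1 / \<alpha> - 1 = (1 - \<alpha>) / \<alpha>"
      using \<alpha>01 by (auto simp: field_simps)
    then show ?thesis
      unfolding mom using \<alpha>01 by simp
  qed
  \<comment> \<open>Measured from \<open>u\<close>, the vectors \<open>a\<close>, \<open>b\<close>
    and \<open>c\<close> are the points \<open>v\<close>, \<open>w\<close> and
    \<open>(1 - \<alpha>) v + \<alpha> w\<close>.\<close>
  define a where "a = w + (1 / \<alpha>) *\<^sub>R (w - p) - u"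
  define b where "b = w - u"
  define c where "c = (1 - \<alpha>) *\<^sub>R a + \<alpha> *\<^sub>R b"
  \<comment> \<open>The step length \<open>1 / L\<close> of \<open>p'\<close>, amplified by
    \<open>1 / \<alpha>\<close>, becomes the step length \<open>\<alpha> / \<kappa>\<close> of
    \<open>v'\<close>.\<close>
  have \<kappa>L: "1 / (\<alpha> * L) = \<alpha> / \<kappa>"
    using \<alpha>2 \<alpha>01 \<kappa> Lpos by (simp add: field_simps power2_eq_square)
  have v': "w' + (1 / \<alpha>) *\<^sub>R (w' - p') - u = c - (\<alpha> / \<kappa>) *\<^sub>R G w"
  proof -
    have "w' + (1 / \<alpha>) *\<^sub>R (w' - p') = p' + ((1 + 1 / \<alpha>) * momentum) *\<^sub>R (p' - p)"
    proof -
      have "p' + m *\<^sub>R (p' - p) + (1 / \<alpha>) *\<^sub>R (p' + m *\<^sub>R (p' - p) - p')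
          = p' + ((1 + 1 / \<alpha>) * m) *\<^sub>R (p' - p)" for m
        by (simp add: scaleR_add_left distrib_right)
      then show ?thesis unfolding w' .
    qed
    also have "\<dots> = p' + (1 / \<alpha> - 1) *\<^sub>R (p' - p)"
      by (simp only: \<open>(1 + 1 / \<alpha>) * momentum = 1 / \<alpha> - 1\<close>)
    also have "\<dots> = (1 / \<alpha>) *\<^sub>R p' + (1 - 1 / \<alpha>) *\<^sub>R p"
      by (simp add: algebra_simps)
    also have "\<dots> = (1 / \<alpha>) *\<^sub>R w + (1 - 1 / \<alpha>) *\<^sub>R p - (\<alpha> / \<kappa>) *\<^sub>R G w"
      unfolding p' \<kappa>L[symmetric] by (simp add: algebra_simps)
    also have "(1 / \<alpha>) *\<^sub>R w + (1 - 1 / \<alpha>) *\<^sub>R p = c + u"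
      using \<alpha>01 unfolding c_def a_def b_def by (simp add: algebra_simps diff_divide_distrib)
    finally show ?thesis by simp
  qed
  have wp: "w - p = \<alpha> *\<^sub>R (a - b)"
    using \<alpha>01 by (simp add: a_def b_def)
  \<comment> \<open>In the sum of the following facts, \<open>F w\<close> is split with weights
    \<open>1 - \<alpha>\<close> and \<open>\<alpha>\<close> and compared with \<open>F p\<close> and
    \<open>F u\<close>; the terms \<open>\<alpha> * (G w \<bullet> c)\<close> and
    \<open>(norm (G w))\<^sup>2 / (2 * L)\<close> cancel.\<close>
  have "F p' \<le> F w - (norm (G w))\<^sup>2 / (2 * L)"
    unfolding p' by (rule gradient_step)
  moreover have "(1 - \<alpha>) * F w \<le> (1 - \<alpha>) * (F p + G w \<bullet> (w - p))"
  proof (rule mult_left_mono)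
    have "0 \<le> \<kappa> / 2 * (norm (p - w))\<^sup>2"
      using \<kappa> by simp
    with lower[of w p] show "F w \<le> F p + G w \<bullet> (w - p)"
      by (simp add: inner_diff_right)
  qed (use \<alpha>01 in auto)
  moreover have "\<alpha> * F w \<le> \<alpha> * (F u + G w \<bullet> b - \<kappa> / 2 * (norm b)\<^sup>2)"
    using lower[of w u] \<alpha>01
    by (intro mult_left_mono) (auto simp: b_def inner_diff_right norm_minus_commute)
  moreover have "(1 - \<alpha>) * (G w \<bullet> (w - p)) + \<alpha> * (G w \<bullet> b) = \<alpha> * (G w \<bullet> c)"
    unfolding wp c_def by (simp add: inner_simps algebra_simps)
  moreover have "\<kappa> / 2 * (norm (c - (\<alpha> / \<kappa>) *\<^sub>R G w))\<^sup>2
      = \<kappa> / 2 * (norm c)\<^sup>2 - \<alpha> * (G w \<bullet> c) + (norm (G w))\<^sup>2 / (2 * L)"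
  proof -
    have "\<kappa> / 2 * (norm (c - (\<alpha> / \<kappa>) *\<^sub>R G w))\<^sup>2
        = \<kappa> / 2 * (norm c)\<^sup>2 - \<alpha> * (G w \<bullet> c) + \<alpha>\<^sup>2 / (2 * \<kappa>) * (norm (G w))\<^sup>2"
      unfolding power2_norm_eq_inner using \<kappa>
      by (simp add: inner_simps inner_commute power2_eq_square field_simps)
    also have "\<alpha>\<^sup>2 / (2 * \<kappa>) = 1 / (2 * L)"
      using \<alpha>2 \<kappa> by (simp add: field_simps)
    finally show ?thesis by simp
  qed
  moreover have "\<kappa> / 2 * (norm c)\<^sup>2 \<le> \<kappa> / 2 * ((1 - \<alpha>) * (norm a)\<^sup>2 + \<alpha> * (norm b)\<^sup>2)"
  proof (rule mult_left_mono)
    have "(norm c)\<^sup>2 = (1 - \<alpha>) * (norm a)\<^sup>2 + \<alpha> * (norm b)\<^sup>2 - \<alpha> * (1 - \<alpha>) * (norm (a - b))\<^sup>2"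
      unfolding power2_norm_eq_inner c_def
      by (simp add: algebra_simps inner_commute)
    moreover have "0 \<le> \<alpha> * (1 - \<alpha>) * (norm (a - b))\<^sup>2"
      using \<alpha>01 by simp
    ultimately show "(norm c)\<^sup>2 \<le> (1 - \<alpha>) * (norm a)\<^sup>2 + \<alpha> * (norm b)\<^sup>2"
      by simp
  qed (use \<kappa> in auto)
  ultimately show ?thesis
    unfolding v' a_def[symmetric] by (simp add: algebra_simps diff_divide_distrib)
qed

lemma fast_gradient_rate:
  assumes min: "\<And>q. F u \<le> F q"
  shows "F (fast_gradient F L \<kappa> p0 k) - F u
    \<le> exp (- sqrt (\<kappa> / L) * real k) * (F p0 - F u + \<kappa> / 2 * (norm (p0 - u))\<^sup>2)"
proof -
  define \<alpha> where "\<alpha> = sqrt (\<kappa> / L)"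
  have \<alpha>: "0 \<le> 1 - \<alpha>"
    using L \<kappa> by (simp add: \<alpha>_def)
  \<comment> \<open>The potential of \<open>lyapunov_step\<close>; as the run starts with both
    points at \<open>p0\<close>, the auxiliary point there is \<open>p0\<close> too.\<close>
  define V where "V = (\<lambda>(p, w). F p - F u + \<kappa> / 2 * (norm (w + (1 / \<alpha>) *\<^sub>R (w - p) - u))\<^sup>2)"
  have step: "V (fast_gradient_run F L \<kappa> p0 (Suc k)) \<le> (1 - \<alpha>) * V (fast_gradient_run F L \<kappa> p0 k)"
    for k
    using lyapunov_step[OF \<alpha>_def refl refl]
    by (auto simp: V_def gradient_eq Let_def split: prod.splits)
  have "V (fast_gradient_run F L \<kappa> p0 k) \<le> (1 - \<alpha>) ^ k * V (p0, p0)" for k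
  proof (induction k)
    case (Suc k)
    show ?case
      using order_trans[OF step mult_left_mono[OF Suc \<alpha>]] by (simp add: mult_ac)
  qed simp
  from this[of k] have "V (fast_gradient_run F L \<kappa> p0 k)
      \<le> (1 - \<alpha>) ^ k * (F p0 - F u + \<kappa> / 2 * (norm (p0 - u))\<^sup>2)"
    by (simp add: V_def)
  moreover have "F (fast_gradient F L \<kappa> p0 k) - F u \<le> V (fast_gradient_run F L \<kappa> p0 k)"
    using \<kappa> by (simp add: V_def fast_gradient_def split: prod.split)
  moreover have "(1 - \<alpha>) ^ k * V0 \<le> exp (- \<alpha> * real k) * V0" if "V0 \<ge> 0" for V0
  proof (rule mult_right_mono[OF _ that])
    have "(1 - \<alpha>) ^ k \<le> exp (- \<alpha>) ^ k"
      using exp_ge_add_one_self[of "- \<alpha>"] \<alpha> by (intro power_mono) auto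
    then show "(1 - \<alpha>) ^ k \<le> exp (- \<alpha> * real k)"
      by (simp add: mult.commute flip: exp_of_nat_mult)
  qed
  moreover have "0 \<le> F p0 - F u + \<kappa> / 2 * (norm (p0 - u))\<^sup>2"
    using min[of p0] \<kappa> by simp
  ultimately show ?thesis
    unfolding \<alpha>_def by (meson order_trans)
qed

end

end

section \<open>Double smoothing\<close>

text \<open>Turns a logarithmic threshold on \<open>k\<close> into a bound for the linear rate; the
  two thresholds correspond to \<open>n = 2\<close> and \<open>n = 3\<close>.\<close>

lemma exp_neg_le_inverse_power:
  fixes B \<alpha> :: real
  assumes "B > 0" "\<alpha> > 0" "real n / \<alpha> * ln B \<le> k"
  shows "exp (- \<alpha> * k) \<le> 1 / B ^ n"
proof -
  have "real n * ln B \<le> \<alpha> * k"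
    using assms by (simp add: field_simps)
  then have "exp (- \<alpha> * k) \<le> exp (- (real n * ln B))"
    by simp
  also have "\<dots> = 1 / B ^ n"
    using assms(1) by (simp add: exp_minus exp_of_nat_mult divide_inverse)
  finally show ?thesis .
qed

text \<open>The squared norm of \<open>adjoint A d\<close> is
  \<open>A (adjoint A d) \<bullet> d\<close>; after Cauchy-Schwarz and the operator norm, one factor
  cancels.\<close>

lemma norm_adjoint_le:
  fixes A :: "'a::euclidean_space \<Rightarrow> 'b::euclidean_space"
  assumes "linear A"
  shows "norm (adjoint A d) \<le> onorm A * norm d"
proof -
  have "(norm (adjoint A d))\<^sup>2 = A (adjoint A d) \<bullet> d"
    by (simp add: power2_norm_eq_inner adjoint_clauses(1)[OF assms])
  also have "\<dots> \<le> norm (A (adjoint A d)) * norm d"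
    by (rule norm_cauchy_schwarz)
  also have "\<dots> \<le> onorm A * norm (adjoint A d) * norm d"
    by (intro mult_right_mono onorm linear_conv_bounded_linear[THEN iffD1] assms) auto
  finally have "norm (adjoint A d) * norm (adjoint A d) \<le> norm (adjoint A d) * (onorm A * norm d)"
    by (simp add: power2_eq_square mult_ac)
  moreover have "0 \<le> onorm A * norm d"
    using assms by (simp add: onorm_pos_le linear_conv_bounded_linear)
  ultimately show ?thesis
    by (cases "adjoint A d = 0") auto
qed

locale double_smoothing = f: bounded_convex_fun f + g: bounded_convex_fun g
  for f :: "'a::euclidean_space \<Rightarrow> ereal" and g :: "'b::euclidean_space \<Rightarrow> ereal" +
  fixes A :: "'a \<Rightarrow> 'b"
  assumes linear: "linear A"
begin

abbreviation real_theta :: "'b \<Rightarrow> real" where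
  "real_theta p \<equiv> real_of_ereal (theta f g A p)"

abbreviation real_theta_smooth :: "real \<Rightarrow> real \<Rightarrow> 'b \<Rightarrow> real" where
  "real_theta_smooth \<rho> \<mu> p \<equiv> real_of_ereal (theta_smooth f g A \<rho> \<mu> p)"

abbreviation real_theta_double_smooth :: "real \<Rightarrow> real \<Rightarrow> real \<Rightarrow> 'b \<Rightarrow> real" where
  "real_theta_double_smooth \<rho> \<mu> \<kappa> p \<equiv> real_of_ereal (theta_double_smooth f g A \<rho> \<mu> \<kappa> p)"

lemma theta_eq:
  "theta f g A p
    = ereal (real_of_ereal (conjugate f (adjoint A p)) + real_of_ereal (conjugate g (- p)))"
  by (simp add: theta_def f.conjugate_finite g.conjugate_finite flip: plus_ereal.simps(1))

lemma theta_smooth_eq: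
  "theta_smooth f g A \<rho> \<mu> p = ereal (real_of_ereal (smooth_conjugate \<rho> f (adjoint A p))
    + real_of_ereal (smooth_conjugate \<mu> g (- p)))"
  by (simp add: theta_smooth_def f.smooth_conjugate_finite g.smooth_conjugate_finite
      flip: plus_ereal.simps(1))

lemma real_theta_double_smooth_eq:
  "real_theta_double_smooth \<rho> \<mu> \<kappa> p = real_theta_smooth \<rho> \<mu> p + \<kappa> / 2 * (norm p)\<^sup>2"
  by (simp add: theta_double_smooth_def theta_smooth_eq)

lemma dual_objective_eq: "dual_objective f g A p = ereal (- real_theta p)"
proof -
  have "dual_objective f g A p = - ereal (real_of_ereal (conjugate f (adjoint A p)))
      - ereal (real_of_ereal (conjugate g (- p)))"
    by (simp only: dual_objective_def f.conjugate_finite g.conjugate_finite)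
  then show ?thesis by (simp add: theta_eq)
qed

lemma
  assumes "dual_objective f g A p = dual_value f g A"
  shows dual_value_eq: "dual_value f g A = ereal (- real_theta p)"
    and real_theta_minimal: "real_theta p \<le> real_theta q"
proof -
  show "dual_value f g A = ereal (- real_theta p)"
    using assms by (simp add: dual_objective_eq)
  moreover have "dual_objective f g A q \<le> dual_value f g A"
    unfolding dual_value_def by (rule SUP_upper) simp
  ultimately show "real_theta p \<le> real_theta q"
    by (simp add: dual_objective_eq)
qed

text \<open>Fenchel-Young for \<open>f\<close> and for \<open>g\<close>: the inner products
  \<open>adjoint A p \<bullet> x\<close> and \<open>(- p) \<bullet> A x\<close> cancel. Off the
  domains the primal objective is infinite.\<close>

lemma weak_duality: "dual_value f g A \<le> primal_value f g A"
  unfolding dual_value_def primal_value_def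
proof (intro SUP_least INF_greatest)
  fix p x
  show "dual_objective f g A p \<le> f x + g (A x)"
  proof (cases "x \<in> effective_dom f \<and> A x \<in> effective_dom g")
    case True
    then have "f.real_objective 0 (adjoint A p) x \<le> real_of_ereal (conjugate f (adjoint A p))"
      "g.real_objective 0 (- p) (A x) \<le> real_of_ereal (conjugate g (- p))"
      by (auto simp: f.conjugate_eq_smooth_conjugate g.conjugate_eq_smooth_conjugate
          intro: f.real_objective_le_smooth_conjugate g.real_objective_le_smooth_conjugate)
    moreover have "adjoint A p \<bullet> x = p \<bullet> A x"
      by (rule adjoint_clauses(2)[OF linear])
    ultimately have "- real_theta p \<le> real_of_ereal (f x) + real_of_ereal (g (A x))"
      by (simp add: theta_eq f.real_objective_def g.real_objective_def)
    then have "ereal (- real_theta p) \<le> ereal (real_of_ereal (f x)) + ereal (real_of_ereal (g (A x)))"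
      by simp
    with True show ?thesis
      by (simp only: dual_objective_eq f.ereal_real_on_dom g.ereal_real_on_dom)
  next
    case False
    then show ?thesis
      using f.not_MInfty[of x] g.not_MInfty[of "A x"] by (auto simp: effective_dom_def)
  qed
qed

section \<open>The smoothed dual function and its maximizers\<close>

context
  fixes \<rho> \<mu> :: real
  assumes \<rho>: "\<rho> > 0" and \<mu>: "\<mu> > 0"
begin

abbreviation primal_f :: "'b \<Rightarrow> 'a" where
  "primal_f p \<equiv> smooth_maximizer \<rho> f (adjoint A p)"

abbreviation primal_g :: "'b \<Rightarrow> 'b" where
  "primal_g p \<equiv> smooth_maximizer \<mu> g (- p)"

lemma theta_smooth_le_theta: "real_theta_smooth \<rho> \<mu> p \<le> real_theta p"
  using f.smooth_conjugate_le_conjugate[OF \<rho>, of "adjoint A p"]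
    g.smooth_conjugate_le_conjugate[OF \<mu>, of "- p"]
  by (simp add: theta_eq theta_smooth_eq)

lemma theta_le_theta_smooth:
  "real_theta p \<le> real_theta_smooth \<rho> \<mu> p
    + (\<rho> * half_sq_radius (effective_dom f) + \<mu> * half_sq_radius (effective_dom g))"
  using f.conjugate_le_smooth_conjugate[OF \<rho>, of "adjoint A p"]
    g.conjugate_le_smooth_conjugate[OF \<mu>, of "- p"]
  by (simp add: theta_eq theta_smooth_eq)

lemma theta_smooth_at_maximizers:
  "real_theta_smooth \<rho> \<mu> p = p \<bullet> (A (primal_f p) - primal_g p)
    - real_of_ereal (f (primal_f p)) - real_of_ereal (g (primal_g p))
    - \<rho> * ((norm (primal_f p))\<^sup>2 / 2) - \<mu> * ((norm (primal_g p))\<^sup>2 / 2)"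
  by (simp add: theta_smooth_eq f.smooth_conjugate_eq[OF \<rho>] g.smooth_conjugate_eq[OF \<mu>]
      f.real_objective_def g.real_objective_def adjoint_clauses(2)[OF linear] inner_diff_right)

text \<open>The bounds for the two smoothed conjugates are pulled back along
  \<open>adjoint A\<close> and negation: \<open>f\<close> contributes
  \<open>(onorm A)\<^sup>2 / \<rho>\<close> and \<open>g\<close> contributes
  \<open>1 / \<mu>\<close> to the upper constant. The regularizer is exactly quadratic and adds
  \<open>\<kappa>\<close> to both constants.\<close>

lemma smooth_strongly_convex_theta:
  assumes \<kappa>: "\<kappa> > 0"
  shows "smooth_strongly_convex (real_theta_double_smooth \<rho> \<mu> \<kappa>)
    (\<lambda>p. A (primal_f p) - primal_g p + \<kappa> *\<^sub>R p) ((onorm A)\<^sup>2 / \<rho> + 1 / \<mu> + \<kappa>) \<kappa>"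
proof
  show "\<kappa> > 0" by (rule \<kappa>)
  fix p q :: 'b
  let ?d = "q - p"
  have sq: "\<kappa> / 2 * (norm q)\<^sup>2 = \<kappa> / 2 * (norm p)\<^sup>2 + \<kappa> * (p \<bullet> ?d) + \<kappa> / 2 * (norm ?d)\<^sup>2"
    unfolding power2_norm_eq_inner by (simp add: inner_diff inner_commute field_simps)
  have adj: "adjoint A q - adjoint A p = adjoint A ?d"
    by (simp add: linear_diff[OF adjoint_linear[OF linear]])
  have fin: "(adjoint A q - adjoint A p) \<bullet> primal_f p = A (primal_f p) \<bullet> ?d"
    unfolding adj adjoint_clauses(2)[OF linear] by (rule inner_commute)
  have gin: "(- q - - p) \<bullet> primal_g p = - (primal_g p \<bullet> ?d)"
    by (simp add: inner_diff inner_commute)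
  show "real_theta_double_smooth \<rho> \<mu> \<kappa> p + (A (primal_f p) - primal_g p + \<kappa> *\<^sub>R p) \<bullet> ?d
      + \<kappa> / 2 * (norm ?d)\<^sup>2 \<le> real_theta_double_smooth \<rho> \<mu> \<kappa> q"
    using f.smooth_conjugate_lower[OF \<rho>, of "adjoint A p" "adjoint A q"]
      g.smooth_conjugate_lower[OF \<mu>, of "- p" "- q"] sq
    unfolding fin gin real_theta_double_smooth_eq theta_smooth_eq
    by (simp add: inner_add_left inner_diff_left add_divide_distrib)
  have "norm (adjoint A ?d) \<le> onorm A * norm ?d"
    by (rule norm_adjoint_le[OF linear])
  then have "(norm (adjoint A q - adjoint A p))\<^sup>2 / (2 * \<rho>) \<le> (onorm A)\<^sup>2 / \<rho> / 2 * (norm ?d)\<^sup>2"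
    using \<rho> power_mono[OF _ norm_ge_zero, of "adjoint A ?d" "onorm A * norm ?d" 2]
    by (simp add: adj field_simps)
  moreover have "(norm (- q - - p))\<^sup>2 / (2 * \<mu>) = 1 / \<mu> / 2 * (norm ?d)\<^sup>2"
    by (simp add: norm_minus_commute)
  ultimately show "real_theta_double_smooth \<rho> \<mu> \<kappa> q \<le> real_theta_double_smooth \<rho> \<mu> \<kappa> p
      + (A (primal_f p) - primal_g p + \<kappa> *\<^sub>R p) \<bullet> ?d
      + ((onorm A)\<^sup>2 / \<rho> + 1 / \<mu> + \<kappa>) / 2 * (norm ?d)\<^sup>2"
    using f.smooth_conjugate_upper[OF \<rho>, of "adjoint A q" "adjoint A p"]
      g.smooth_conjugate_upper[OF \<mu>, of "- q" "- p"] sq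
    unfolding fin gin real_theta_double_smooth_eq theta_smooth_eq
    by (simp add: inner_add_left inner_diff_left add_divide_distrib distrib_right)
qed

end

text \<open>The parameters balance three errors: \<open>\<rho> * Df\<close> and
  \<open>\<mu> * Dg\<close> both equal \<open>\<epsilon> / 4\<close>, and the regularizer at
  \<open>pstar\<close> is at most \<open>\<epsilon> / 4\<close>.\<close>

lemma fast_gradient_accuracy:
  fixes R Df Dg \<epsilon> :: real and k :: nat
  assumes \<epsilon>: "\<epsilon> > 0" and R: "R > 0" "norm pstar \<le> R"
    and Df: "Df = half_sq_radius (effective_dom f)" "Df > 0"
    and Dg: "Dg = half_sq_radius (effective_dom g)" "Dg > 0"
    and pstar: "\<And>q. real_theta pstar \<le> real_theta q"
  assumes \<rho>_def: "\<rho> = \<epsilon> / (4 * Df)" and \<mu>_def: "\<mu> = \<epsilon> / (4 * Dg)" and \<kappa>_def: "\<kappa> = \<epsilon> / (2 * R\<^sup>2)"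
    and K_def: "K = (onorm A)\<^sup>2 * Df + Dg"
    and X_def: "X = real_theta 0 - real_theta pstar + \<epsilon> / 2"
  assumes L_def: "L = (onorm A)\<^sup>2 / \<rho> + 1 / \<mu> + \<kappa>"
  assumes p_def: "p = fast_gradient (real_theta_double_smooth \<rho> \<mu> \<kappa>) L \<kappa> 0 k"
  assumes x_def: "x = smooth_maximizer \<rho> f (adjoint A p)" and y_def: "y = smooth_maximizer \<mu> g (- p)"
  assumes k1: "2 / \<epsilon> * sqrt (\<epsilon>\<^sup>2 + 8 * R\<^sup>2 * K) * ln (25 * X / (2 * \<epsilon>)) \<le> real k"
    and k2: "3 / \<epsilon> * sqrt (\<epsilon>\<^sup>2 + 8 * R\<^sup>2 * K)
      * ln (root 3 ((2 * \<epsilon>\<^sup>2 + 16 * R\<^sup>2 * K) * X) / ((2 - sqrt 3) powr (2 / 3) * \<epsilon>)) \<le> real k"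
  shows "norm (A x - y) \<le> 2 * \<epsilon> / R"
    and "\<bar>real_of_ereal (f x) + real_of_ereal (g y) + real_theta pstar\<bar> \<le> 2 * (1 + 2 * sqrt 3) * \<epsilon>"
proof -
  have pos: "\<rho> > 0" "\<mu> > 0" "\<kappa> > 0"
    using \<epsilon> R Df Dg by (simp_all add: \<rho>_def \<mu>_def \<kappa>_def)
  have K: "K > 0"
    using Df Dg by (simp add: K_def add_nonneg_pos)
  have X: "X \<ge> \<epsilon> / 2" "X > 0"
    using pstar[of 0] \<epsilon> by (simp_all add: X_def add_nonneg_pos)
  have L: "L = 4 * K / \<epsilon> + \<kappa>"
    unfolding L_def K_def \<rho>_def \<mu>_def using \<epsilon> by (simp add: field_simps)
  have L\<kappa>: "\<kappa> \<le> L"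
    using K \<epsilon> by (simp add: L)
  have Lpos: "L > 0"
    using pos L\<kappa> by linarith
  define \<alpha> where "\<alpha> = sqrt (\<kappa> / L)"
  have \<alpha>: "\<alpha> > 0"
    using pos Lpos by (simp add: \<alpha>_def)
  \<comment> \<open>A factor under the cube root of the second threshold; displaying
    \<open>L\<close> lets it cancel against the \<open>2 * L\<close> of
    \<open>gradient_le_gap\<close>.\<close>
  have RL: "2 * \<epsilon>\<^sup>2 + 16 * R\<^sup>2 * K = 4 * \<epsilon> * R\<^sup>2 * L"
    unfolding L \<kappa>_def using \<epsilon> R by (simp add: field_simps power2_eq_square)
  \<comment> \<open>The common prefactor of both thresholds, which therefore read
    \<open>2 / \<alpha>\<close> and \<open>3 / \<alpha>\<close> times a logarithm.\<close>
  have \<alpha>_inv: "1 / \<alpha> = sqrt (\<epsilon>\<^sup>2 + 8 * R\<^sup>2 * K) / \<epsilon>"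
  proof -
    have "L / \<kappa> = (\<epsilon>\<^sup>2 + 8 * R\<^sup>2 * K) / \<epsilon>\<^sup>2"
      unfolding L \<kappa>_def using \<epsilon> R by (simp add: field_simps power2_eq_square)
    then have "sqrt (L / \<kappa>) = sqrt (\<epsilon>\<^sup>2 + 8 * R\<^sup>2 * K) / \<epsilon>"
      using \<epsilon> by (simp add: real_sqrt_divide)
    then show ?thesis
      by (simp add: \<alpha>_def real_sqrt_divide)
  qed
  have exp1: "exp (- \<alpha> * real k) \<le> 4 * \<epsilon>\<^sup>2 / (625 * X\<^sup>2)"
  proof -
    have "real 2 / \<alpha> = 2 * (1 / \<alpha>)" by simp
    then have "real 2 / \<alpha> * ln (25 * X / (2 * \<epsilon>)) \<le> real k"
      using k1 unfolding \<alpha>_inv by simp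
    then have "exp (- \<alpha> * real k) \<le> 1 / (25 * X / (2 * \<epsilon>)) ^ 2"
      using X \<epsilon> \<alpha> by (intro exp_neg_le_inverse_power) auto
    then show ?thesis
      by (simp add: power_divide power_mult_distrib)
  qed
  \<comment> \<open>Complements the coefficient \<open>sqrt 3\<close> of the regularization term to
    the 2 in the bound \<open>2 * \<epsilon> / R\<close>.\<close>
  define c where "c = 2 - sqrt 3"
  have sqrt3: "1 < sqrt 3" "sqrt 3 < 2"
    by (auto simp: real_less_lsqrt real_less_rsqrt)
  have c: "c > 0"
    using sqrt3 by (simp add: c_def)
  have exp2: "exp (- \<alpha> * real k) \<le> c\<^sup>2 * \<epsilon>\<^sup>2 / (4 * R\<^sup>2 * L * X)"
  proof -
    let ?Y = "4 * \<epsilon> * R\<^sup>2 * L * X"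
    have Y: "?Y > 0"
      using \<epsilon> R Lpos X by simp
    have "real 3 / \<alpha> = 3 * (1 / \<alpha>)" by simp
    then have "real 3 / \<alpha> * ln (root 3 ?Y / (c powr (2 / 3) * \<epsilon>)) \<le> real k"
      using k2 unfolding \<alpha>_inv RL c_def by simp
    then have "exp (- \<alpha> * real k) \<le> 1 / (root 3 ?Y / (c powr (2 / 3) * \<epsilon>)) ^ 3"
      using Y c \<epsilon> \<alpha> by (intro exp_neg_le_inverse_power) auto
    \<comment> \<open>Cubing removes the root and turns the exponent \<open>2 / 3\<close> of
      \<open>c\<close> into 2.\<close>
    also have "\<dots> = (c powr (2 / 3)) ^ 3 * \<epsilon> ^ 3 / ?Y"
      unfolding power_divide power_mult_distrib[of _ \<epsilon>] real_root_pow_pos[OF zero_less_numeral Y]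
      by simp
    also have "(c powr (2 / 3)) ^ 3 = c\<^sup>2"
      using c by (simp add: powr_power)
    finally show ?thesis
      using \<epsilon> by (simp add: power2_eq_square power3_eq_cube mult_ac)
  qed

  let ?F = "real_theta_double_smooth \<rho> \<mu> \<kappa>"
  let ?T = "real_theta_smooth \<rho> \<mu>"
  interpret F: smooth_strongly_convex ?F
    "\<lambda>p. A (smooth_maximizer \<rho> f (adjoint A p)) - smooth_maximizer \<mu> g (- p) + \<kappa> *\<^sub>R p" L \<kappa>
    unfolding L_def using pos by (intro smooth_strongly_convex_theta)
  obtain m where m: "\<And>q. ?F m \<le> ?F q"
    using F.attains_min by blast
  have radii: "\<rho> * half_sq_radius (effective_dom f) + \<mu> * half_sq_radius (effective_dom g) = \<epsilon> / 2"
    unfolding Df(1)[symmetric] Dg(1)[symmetric] \<rho>_def \<mu>_def using Df Dg by simp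
  have le_T: "real_theta q \<le> ?T q + \<epsilon> / 2" for q
    using theta_le_theta_smooth[OF pos(1,2), of q] by (simp add: radii)
  have T_le: "?T q \<le> real_theta q" for q
    by (rule theta_smooth_le_theta[OF pos(1,2)])
  have F: "?F q = ?T q + \<kappa> / 2 * (norm q)\<^sup>2" for q
    by (rule real_theta_double_smooth_eq)
  have T_low: "real_theta pstar - \<epsilon> / 2 \<le> ?T q" for q
    using le_T[of q] pstar[of q] by simp
  have F_low: "real_theta pstar - \<epsilon> / 2 + \<kappa> / 2 * (norm q)\<^sup>2 \<le> ?F q" for q
    using T_low[of q] by (simp add: F)
  have gap0: "?F 0 - ?F m \<le> X"
  proof -
    have "0 \<le> \<kappa> / 2 * (norm m)\<^sup>2" "?F 0 = ?T 0"
      using pos by (simp_all add: F)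
    then show ?thesis
      using F_low[of m] T_le[of 0] by (simp add: X_def)
  qed
  have gap: "?F p - ?F m \<le> exp (- \<alpha> * real k) * (2 * X)"
  proof -
    have "?F p - ?F m \<le> exp (- \<alpha> * real k) * (?F 0 - ?F m + \<kappa> / 2 * (norm (0 - m))\<^sup>2)"
      unfolding p_def \<alpha>_def by (rule F.fast_gradient_rate[OF L\<kappa> m])
    \<comment> \<open>Quadratic growth bounds the distance term of the initial potential by the
      initial gap once more, whence the factor 2.\<close>
    also have "\<dots> \<le> exp (- \<alpha> * real k) * (2 * X)"
      using F.quadratic_growth[OF L\<kappa> m, of 0] gap0 by (intro mult_left_mono) auto
    finally show ?thesis .
  qed
  have gap1: "?F p - ?F m \<le> 16 / 625 * \<epsilon>"
  proof -
    note gap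
    also have "exp (- \<alpha> * real k) * (2 * X) \<le> 4 * \<epsilon>\<^sup>2 / (625 * X\<^sup>2) * (2 * X)"
      using X by (intro mult_right_mono exp1) auto
    also have "\<dots> = 8 / 625 * \<epsilon> * (\<epsilon> / X)"
      using X by (simp add: power2_eq_square)
    \<comment> \<open>The ratio \<open>\<epsilon> / X\<close> is at most 2 because \<open>X\<close>
      contains the summand \<open>\<epsilon> / 2\<close>.\<close>
    also have "\<dots> \<le> 8 / 625 * \<epsilon> * 2"
      using X \<epsilon> by (intro mult_left_mono) (auto simp: field_simps)
    finally show ?thesis by simp
  qed
  have gap2: "?F p - ?F m \<le> c\<^sup>2 * \<epsilon>\<^sup>2 / (2 * R\<^sup>2 * L)"
  proof -
    note gap
    also have "exp (- \<alpha> * real k) * (2 * X) \<le> c\<^sup>2 * \<epsilon>\<^sup>2 / (4 * R\<^sup>2 * L * X) * (2 * X)"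
      using X by (intro mult_right_mono exp2) auto
    also have "\<dots> = c\<^sup>2 * \<epsilon>\<^sup>2 / (2 * R\<^sup>2 * L)"
      using X by (simp add: field_simps)
    finally show ?thesis .
  qed
  have F_pstar: "?F m \<le> real_theta pstar + \<epsilon> / 4"
  proof -
    have "\<kappa> / 2 * (norm pstar)\<^sup>2 \<le> \<kappa> / 2 * R\<^sup>2"
      using R pos by (intro mult_left_mono power_mono) auto
    also have "\<dots> = \<epsilon> / 4"
      using R by (simp add: \<kappa>_def)
    finally show ?thesis
      using m[of pstar] T_le[of pstar] by (simp add: F)
  qed
  have norm_m: "norm m \<le> sqrt 3 * R"
  proof -
    \<comment> \<open>\<open>F_low\<close> and \<open>F_pstar\<close> leave
      \<open>3 * \<epsilon> / 4\<close> for the regularizer at \<open>m\<close>, which is its value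
      at norm \<open>sqrt 3 * R\<close>.\<close>
    have "\<kappa> / 2 * (norm m)\<^sup>2 \<le> \<kappa> / 2 * (3 * R\<^sup>2)"
      using F_low[of m] F_pstar R by (simp add: \<kappa>_def)
    then have "(norm m)\<^sup>2 \<le> (sqrt 3 * R)\<^sup>2"
      using pos by (simp add: power_mult_distrib)
    then show ?thesis
      by (rule power2_le_imp_le) (use R in simp)
  qed
  have "norm (p - m) \<le> 8 / 25 * R"
  proof -
    have "\<kappa> / 2 * (norm (p - m))\<^sup>2 \<le> 16 / 625 * \<epsilon>"
      using F.quadratic_growth[OF L\<kappa> m, of p] gap1 by linarith
    also have "\<dots> = \<kappa> / 2 * (8 / 25 * R)\<^sup>2"
      using R by (simp add: \<kappa>_def power2_eq_square)
    finally have "(norm (p - m))\<^sup>2 \<le> (8 / 25 * R)\<^sup>2"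
      using pos by simp
    then show ?thesis
      by (rule power2_le_imp_le) (use R in simp)
  qed
  moreover have "8 / 25 * R \<le> sqrt 3 * R"
    by (rule mult_right_mono) (use R sqrt3(1) in linarith)+
  ultimately have norm_p: "norm p \<le> 2 * sqrt 3 * R"
    using norm_m norm_triangle_sub[of p m] by linarith
  have grad: "norm (A x - y + \<kappa> *\<^sub>R p) \<le> c * \<epsilon> / R"
  proof -
    have "(norm (A x - y + \<kappa> *\<^sub>R p))\<^sup>2 \<le> 2 * L * (?F p - ?F m)"
      unfolding x_def y_def by (rule F.gradient_le_gap[OF L\<kappa> m])
    also have "\<dots> \<le> 2 * L * (c\<^sup>2 * \<epsilon>\<^sup>2 / (2 * R\<^sup>2 * L))"
      using Lpos by (intro mult_left_mono gap2) auto
    also have "\<dots> = (c * \<epsilon> / R)\<^sup>2"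
      using Lpos by (simp add: power_divide power_mult_distrib)
    finally show ?thesis
      by (rule power2_le_imp_le) (use c \<epsilon> R in simp)
  qed
  show infeas: "norm (A x - y) \<le> 2 * \<epsilon> / R"
  proof -
    have "norm (\<kappa> *\<^sub>R p) \<le> \<kappa> * (2 * sqrt 3 * R)"
      using norm_p pos by simp
    also have "\<dots> = sqrt 3 * \<epsilon> / R"
      using R by (simp add: \<kappa>_def power2_eq_square)
    finally have "norm (A x - y) \<le> c * \<epsilon> / R + sqrt 3 * \<epsilon> / R"
      using grad norm_triangle_ineq4[of "A x - y + \<kappa> *\<^sub>R p" "\<kappa> *\<^sub>R p"] by simp
    also have "\<dots> = 2 * \<epsilon> / R"
      by (simp add: c_def left_diff_distrib flip: add_divide_distrib)
    finally show ?thesis .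
  qed
  \<comment> \<open>The smoothing terms at the maximizers, between 0 and
    \<open>\<epsilon> / 2\<close>. Since \<open>?T p\<close> lies between
    \<open>real_theta pstar - \<epsilon> / 2\<close> and
    \<open>real_theta pstar + \<epsilon>\<close>, the error apart from the inner product is at most
    \<open>3 * \<epsilon> / 2\<close>, within the allowed \<open>2 * \<epsilon>\<close>.\<close>
  define r where "r = \<rho> * ((norm x)\<^sup>2 / 2) + \<mu> * ((norm y)\<^sup>2 / 2)"
  have "r \<le> \<epsilon> / 2"
    unfolding r_def radii[symmetric] x_def y_def using pos
    by (intro add_mono mult_left_mono f.half_sq_norm_le_radius g.half_sq_norm_le_radius
        f.smooth_maximizer_in_dom g.smooth_maximizer_in_dom) auto
  moreover have "r \<ge> 0"
    using pos by (simp add: r_def)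
  moreover have "?T p = p \<bullet> (A x - y) - real_of_ereal (f x) - real_of_ereal (g y) - r"
    using theta_smooth_at_maximizers[OF pos(1,2), of p] by (simp add: x_def y_def r_def)
  moreover have "\<bar>p \<bullet> (A x - y)\<bar> \<le> 4 * sqrt 3 * \<epsilon>"
  proof -
    have "\<bar>p \<bullet> (A x - y)\<bar> \<le> norm p * norm (A x - y)"
      by (rule Cauchy_Schwarz_ineq2)
    also have "\<dots> \<le> 2 * sqrt 3 * R * (2 * \<epsilon> / R)"
      using R by (intro mult_mono norm_p infeas) auto
    finally show ?thesis
      using R by simp
  qed
  moreover have "?T p \<le> real_theta pstar + \<epsilon>"
  proof -
    have "?T p \<le> ?F p"
      using pos by (simp add: F)
    then show ?thesis
      using gap1 F_pstar \<epsilon> by linarith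
  qed
  moreover note T_low[of p]
  moreover have "2 * (1 + 2 * sqrt 3) * \<epsilon> = 2 * \<epsilon> + 4 * sqrt 3 * \<epsilon>"
    by (simp add: algebra_simps)
  ultimately show "\<bar>real_of_ereal (f x) + real_of_ereal (g y) + real_theta pstar\<bar>
      \<le> 2 * (1 + 2 * sqrt 3) * \<epsilon>"
    using \<epsilon> by linarith
qed

end

section \<open>The number of iterations\<close>

text \<open>The ceiling of the larger threshold is admissible; the absolute values cover negative
  thresholds, where \<open>nat\<close> gives 0.\<close>

lemma real_Least_nat_le:
  fixes a b :: real
  shows "real (LEAST k. a \<le> real k \<and> b \<le> real k) \<le> \<bar>a\<bar> + \<bar>b\<bar> + 1"
proof -
  let ?k = "nat \<lceil>max a b\<rceil>"
  have "(LEAST k. a \<le> real k \<and> b \<le> real k) \<le> ?k"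
    by (rule Least_le) linarith
  then have "real (LEAST k. a \<le> real k \<and> b \<le> real k) \<le> real ?k"
    by simp
  also have "\<dots> \<le> \<bar>a\<bar> + \<bar>b\<bar> + 1"
    by linarith
  finally show ?thesis .
qed

text \<open>The third assumption absorbs the rounding up to an integer.\<close>

lemma Least_iteration_bigo:
  assumes "N1 \<in> O[F](h)" "N2 \<in> O[F](h)" "(\<lambda>_. 1) \<in> O[F](h)"
  shows "(\<lambda>\<epsilon>. real (LEAST k. N1 \<epsilon> \<le> real k \<and> N2 \<epsilon> \<le> real k)) \<in> O[F](h :: 'a \<Rightarrow> real)"
proof -
  have "(\<lambda>\<epsilon>. real (LEAST k. N1 \<epsilon> \<le> real k \<and> N2 \<epsilon> \<le> real k))
      \<in> O[F](\<lambda>\<epsilon>. \<bar>N1 \<epsilon>\<bar> + \<bar>N2 \<epsilon>\<bar> + 1)"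
    by (intro bigoI[of _ 1] always_eventually allI) (use real_Least_nat_le in simp)
  moreover have "(\<lambda>\<epsilon>. \<bar>N1 \<epsilon>\<bar> + \<bar>N2 \<epsilon>\<bar> + 1) \<in> O[F](h)"
    using assms by (intro sum_in_bigo) auto
  ultimately show ?thesis
    by (rule landau_o.big_trans)
qed

lemma first_threshold_bigo:
  fixes c \<Delta> :: real
  assumes "c > 0" "\<Delta> \<ge> 0"
  shows "(\<lambda>\<epsilon>. 2 / \<epsilon> * sqrt (\<epsilon>\<^sup>2 + c) * ln (25 * (\<Delta> + \<epsilon> / 2) / (2 * \<epsilon>)))
    \<in> O[at_right 0](\<lambda>\<epsilon>. 1 / \<epsilon> * ln (1 / \<epsilon>))"
\<comment> \<open>The expansions differ: for \<open>\<Delta> = 0\<close> the logarithm is the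
  constant \<open>ln (25 / 4)\<close>, otherwise it grows like
  \<open>ln (1 / \<epsilon>)\<close>.\<close>
proof (cases "\<Delta> = 0")
  case True
  show ?thesis
    unfolding True using assms by real_asymp
next
  case False
  with assms have "\<Delta> > 0" by simp
  with assms show ?thesis by real_asymp
qed

text \<open>Here \<open>c\<close> stands for \<open>8 * R\<^sup>2 * K\<close> and \<open>d\<close>
  for \<open>(2 - sqrt 3) powr (2 / 3)\<close>. Up to constants the logarithm's argument behaves
  like \<open>\<epsilon> powr (- 2 / 3)\<close> if \<open>\<Delta> = 0\<close> and like
  \<open>1 / \<epsilon>\<close> otherwise.\<close>

lemma second_threshold_bigo:
  fixes c d \<Delta> :: real
  assumes "c > 0" "d > 0" "\<Delta> \<ge> 0"
  shows "(\<lambda>\<epsilon>. 3 / \<epsilon> * sqrt (\<epsilon>\<^sup>2 + c) *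
      ln (root 3 ((2 * \<epsilon>\<^sup>2 + 2 * c) * (\<Delta> + \<epsilon> / 2)) / (d * \<epsilon>)))
    \<in> O[at_right 0](\<lambda>\<epsilon>. 1 / \<epsilon> * ln (1 / \<epsilon>))"
proof (cases "\<Delta> = 0")
  case True
  show ?thesis
    unfolding True using assms by real_asymp
next
  case False
  with assms have "\<Delta> > 0" by simp
  with assms show ?thesis by real_asymp
qed

text \<open>The complexity claim is the last conjunct: \<open>LEAST k\<close> is the first iteration
  from which both thresholds hold, as a function of \<open>\<epsilon>\<close> for fixed
  data.\<close>

theorem mainTheorem3:
  fixes f :: "real ^ 'n \<Rightarrow> ereal"
    and g :: "real ^ 'm \<Rightarrow> ereal"
    and A :: "real ^ 'n \<Rightarrow> real ^ 'm"
    and pstar :: "real ^ 'm"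
    and R Df Dg :: real
    and N1 N2 :: "real \<Rightarrow> real"
  assumes f: "proper_fun f" "ereal_convex f" "lower_semicontinuous f" "bounded (effective_dom f)"
    and g: "proper_fun g" "ereal_convex g" "lower_semicontinuous g" "bounded (effective_dom g)"
    and A: "linear A"
    and feasible: "A ` effective_dom f \<inter> effective_dom g \<noteq> {}"
    and pstar: "dual_objective f g A pstar = dual_value f g A"
    and R: "R > 0" "norm pstar \<le> R"
    and Df: "Df = half_sq_radius (effective_dom f)" "Df > 0"
    and Dg: "Dg = half_sq_radius (effective_dom g)" "Dg > 0"
    and N1: "\<And>\<epsilon>. N1 \<epsilon> =
        2 / \<epsilon> * sqrt (\<epsilon>\<^sup>2 + 8 * R\<^sup>2 * ((onorm A)\<^sup>2 * Df + Dg)) *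
        ln (25 * (real_of_ereal (theta f g A 0) - real_of_ereal (theta f g A pstar) + \<epsilon> / 2) /
            (2 * \<epsilon>))"
    and N2: "\<And>\<epsilon>. N2 \<epsilon> =
        3 / \<epsilon> * sqrt (\<epsilon>\<^sup>2 + 8 * R\<^sup>2 * ((onorm A)\<^sup>2 * Df + Dg)) *
        ln (root 3 ((2 * \<epsilon>\<^sup>2 + 16 * R\<^sup>2 * ((onorm A)\<^sup>2 * Df + Dg)) *
                    (real_of_ereal (theta f g A 0) - real_of_ereal (theta f g A pstar) + \<epsilon> / 2)) /
            ((2 - sqrt 3) powr (2 / 3) * \<epsilon>))"
  shows "(\<forall>\<epsilon>>0.
           let \<rho> = \<epsilon> / (4 * Df);
               \<mu> = \<epsilon> / (4 * Dg);
               \<kappa> = \<epsilon> / (2 * R\<^sup>2);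
               L = (onorm A)\<^sup>2 / \<rho> + 1 / \<mu> + \<kappa>;
               p = fast_gradient (\<lambda>q. real_of_ereal (theta_double_smooth f g A \<rho> \<mu> \<kappa> q)) L \<kappa> 0
           in \<forall>k. N1 \<epsilon> \<le> real k \<and> N2 \<epsilon> \<le> real k \<longrightarrow>
                (let x = smooth_maximizer \<rho> f (adjoint A (p k));
                     y = smooth_maximizer \<mu> g (- p k)
                 in x \<in> effective_dom f \<and>
                    y \<in> effective_dom g \<and>
                    \<bar>f x + g y - dual_value f g A\<bar> \<le> ereal (2 * (1 + 2 * sqrt 3) * \<epsilon>) \<and>
                    norm (A x - y) \<le> 2 * \<epsilon> / R \<and>
                    f x + g y \<le> primal_value f g A + ereal (2 * (1 + 2 * sqrt 3) * \<epsilon>)))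
       \<and> (\<lambda>\<epsilon>. real (LEAST k. N1 \<epsilon> \<le> real k \<and> N2 \<epsilon> \<le> real k))
           \<in> O[at_right 0](\<lambda>\<epsilon>. 1 / \<epsilon> * ln (1 / \<epsilon>))"
proof (intro conjI)
  interpret double_smoothing f g A
    by (intro double_smoothing.intro bounded_convex_fun.intro double_smoothing_axioms.intro f g A)
  define \<Delta> where "\<Delta> = real_theta 0 - real_theta pstar"
  define K where "K = (onorm A)\<^sup>2 * Df + Dg"
  have K: "K > 0"
    using Df Dg by (simp add: K_def add_nonneg_pos)
  have \<Delta>: "\<Delta> \<ge> 0"
    using real_theta_minimal[OF pstar, of 0] by (simp add: \<Delta>_def)
  show "\<forall>\<epsilon>>0.
           let \<rho> = \<epsilon> / (4 * Df);
               \<mu> = \<epsilon> / (4 * Dg);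
               \<kappa> = \<epsilon> / (2 * R\<^sup>2);
               L = (onorm A)\<^sup>2 / \<rho> + 1 / \<mu> + \<kappa>;
               p = fast_gradient (\<lambda>q. real_of_ereal (theta_double_smooth f g A \<rho> \<mu> \<kappa> q)) L \<kappa> 0
           in \<forall>k. N1 \<epsilon> \<le> real k \<and> N2 \<epsilon> \<le> real k \<longrightarrow>
                (let x = smooth_maximizer \<rho> f (adjoint A (p k));
                     y = smooth_maximizer \<mu> g (- p k)
                 in x \<in> effective_dom f \<and>
                    y \<in> effective_dom g \<and>
                    \<bar>f x + g y - dual_value f g A\<bar> \<le> ereal (2 * (1 + 2 * sqrt 3) * \<epsilon>) \<and>
                    norm (A x - y) \<le> 2 * \<epsilon> / R \<and>
                    f x + g y \<le> primal_value f g A + ereal (2 * (1 + 2 * sqrt 3) * \<epsilon>))"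
    unfolding Let_def
  proof (intro allI impI, elim conjE)
    fix \<epsilon> :: real and k :: nat
    let ?\<rho> = "\<epsilon> / (4 * Df)" and ?\<mu> = "\<epsilon> / (4 * Dg)" and ?\<kappa> = "\<epsilon> / (2 * R\<^sup>2)"
    let ?p = "fast_gradient (\<lambda>q. real_of_ereal (theta_double_smooth f g A ?\<rho> ?\<mu> ?\<kappa> q))
      ((onorm A)\<^sup>2 / ?\<rho> + 1 / ?\<mu> + ?\<kappa>) ?\<kappa> 0 k"
    let ?x = "smooth_maximizer ?\<rho> f (adjoint A ?p)" and ?y = "smooth_maximizer ?\<mu> g (- ?p)"
    let ?b = "2 * (1 + 2 * sqrt 3) * \<epsilon>"
    assume \<epsilon>: "\<epsilon> > 0" and k: "N1 \<epsilon> \<le> real k" "N2 \<epsilon> \<le> real k"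
    have x: "?x \<in> effective_dom f" and y: "?y \<in> effective_dom g"
      using \<epsilon> Df Dg by (auto intro!: f.smooth_maximizer_in_dom g.smooth_maximizer_in_dom)
    note acc = fast_gradient_accuracy[OF \<epsilon> R Df Dg real_theta_minimal[OF pstar]
        refl refl refl refl refl refl refl refl refl k(1)[unfolded N1] k(2)[unfolded N2]]
    have fg: "f ?x + g ?y = ereal (real_of_ereal (f ?x) + real_of_ereal (g ?y))"
      using f.ereal_real_on_dom[OF x] g.ereal_real_on_dom[OF y] by (metis plus_ereal.simps(1))
    have gap: "\<bar>f ?x + g ?y - dual_value f g A\<bar> \<le> ereal ?b"
      using acc(2) unfolding fg dual_value_eq[OF pstar] by simp
    \<comment> \<open>One side of the gap estimate; weak duality then replaces the dual value by the
      primal one.\<close>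
    have "f ?x + g ?y \<le> dual_value f g A + ereal ?b"
      using acc(2) unfolding fg dual_value_eq[OF pstar] by simp
    also have "\<dots> \<le> primal_value f g A + ereal ?b"
      by (intro add_right_mono weak_duality)
    finally show "?x \<in> effective_dom f \<and> ?y \<in> effective_dom g \<and>
        \<bar>f ?x + g ?y - dual_value f g A\<bar> \<le> ereal ?b \<and> norm (A ?x - ?y) \<le> 2 * \<epsilon> / R \<and>
        f ?x + g ?y \<le> primal_value f g A + ereal ?b"
      using x y gap acc(1) by blast
  qed
  have c: "8 * R\<^sup>2 * K > 0"
    using R K by simp
  have d: "(2 - sqrt 3) powr (2 / 3) > 0"
    by (simp add: real_less_lsqrt less_imp_neq)
  show "(\<lambda>\<epsilon>. real (LEAST k. N1 \<epsilon> \<le> real k \<and> N2 \<epsilon> \<le> real k))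
      \<in> O[at_right 0](\<lambda>\<epsilon>. 1 / \<epsilon> * ln (1 / \<epsilon>))"
  proof (rule Least_iteration_bigo)
    show "N1 \<in> O[at_right 0](\<lambda>\<epsilon>. 1 / \<epsilon> * ln (1 / \<epsilon>))"
      using first_threshold_bigo[OF c \<Delta>] by (simp add: N1 [abs_def] K_def \<Delta>_def)
    show "N2 \<in> O[at_right 0](\<lambda>\<epsilon>. 1 / \<epsilon> * ln (1 / \<epsilon>))"
      using second_threshold_bigo[OF c d \<Delta>] by (simp add: N2 [abs_def] K_def \<Delta>_def mult.assoc)
  qed real_asymp
qed

end
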